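(* Let $n\ge2$, $X=\mathbb{R}_+^n$ (the non-negative orthant), $\mathcal{A}\subset\mathbb{R}^n$ a non-empty finite set, and $\beta\in\mathcal{A}$. A normalized element $\lambda\in N_\beta$ (i.e. $\lambda_\beta=-1$) with $|\lambda^+|\ge2$ is contained in $\Lambda_X(\mathcal{A},\beta)$ if and only if there exists a non-empty subset $S\subset[n]$ with $|\{\alpha_S : \alpha\in\operatorname{supp}\lambda\}|=|\operatorname{supp}\lambda|$ such that $\lambda$ is an $\mathbb{R}^{|S|}$-circuit for the support set $\mathcal{A}_S$ and $(\mathcal{A}\lambda)_{[n]\setminus S}>\mathbf{0}$.
   Context: $[n]=\{1,\ldots,n\}$. $\mathbb{R}^{\mathcal{A}}$ is the set of real vectors indexed by $\mathcal{A}$. For $\beta\in\mathcal{A}$, $N_\beta=\{\nu\in\mathbb{R}^{\mathcal{A}} : \nu_\alpha\ge 0 \text{ for all }\alpha\in\mathcal{A}\setminus\{\beta\},\ \sum_{\alpha\in\mathcal{A}}\nu_\alpha=0\}$. For $\nu\in\mathbb{R}^{\mathcal{A}}$ write $\mathcal{A}\nu=\sum_{\alpha\in\mathcal{A}}\alpha\,\nu_\alpha\in\mathbb{R}^n$. For a non-empty convex set $X\subset\mathbb{R}^n$, $\sigma_X(y)=\sup\{y^Tx : x\in X\}$ is the support function. A non-zero vector $\nu^*\in N_\beta$ is an $X$-circuit for the support set $\mathcal{A}$ (sublinear circuit of $\mathcal{A}$ with respect to $X$) if (i) $\sigma_X(-\mathcal{A}\nu^* )<\infty$, and (ii) whenever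 the map $\nu\mapsto\sigma_X(-\mathcal{A}\nu)$ is linear on a two-dimensional convex cone contained in $N_\beta$ (i.e. is finite there and coincides there with a linear function), $\nu^*$ is not in the relative interior of that cone. The same definition applies to any dimension, finite support set and convex set. $\Lambda_X(\mathcal{A},\beta)$ denotes the set of $X$-circuits $\lambda\in N_\beta$ with $\lambda_\beta=-1$. $\operatorname{supp}\lambda=\{\alpha\in\mathcal{A}:\lambda_\alpha\neq0\}$ and $\lambda^+=\{\alpha\in\mathcal{A}:\lambda_\alpha>0\}$. For $S\subset[n]$ and $v\in\mathbb{R}^n$, $v_S=(v_s)_{s\in S}$, and $\mathcal{A}_S=\{\alpha_S:\alpha\in\mathcal{A}\}$. The inequality $v>\mathbf{0}$ for vectors is componentwise strict (and holds vacuously for vectors with no components). When $\alpha\mapsto\alpha_S$ is injective on $\operatorname{supp}\lambda$, $\lambda$ is regarded as the vector in $\mathbb{R}^{\mathcal{A}_S}$ whose entry at $\alpha_S$ is $\lambda_\alpha$ for $\alpha\in\operatorname{supp}\lambda$ and whose other entries are $0$; "$\lambda$ is an $\mathbb{R}^{|S|}$-circuit for $\mathcal{A}_S$" refers to this vector. *)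

theory Defs
  imports "HOL-Analysis.Analysis" "HOL-Analysis.Finite_Function_Topology"
begin

text \<open>
  Since the coordinate set varies (\<open>[n]\<close> and its subsets \<open>S\<close>), points of \<open>\<real>\<^sup>I\<close> are the extensional
  functions \<^term>\<open>I \<rightarrow>\<^sub>E (UNIV :: real set)\<close>, so that \<open>v\<^sub>S\<close> is \<^term>\<open>restrict v S\<close>.
  Vectors in \<open>\<real>\<^sup>A\<close>, for a finite set \<open>A\<close> of such points, are the finitely supported functions
  \<open>\<nu> :: ('i \<Rightarrow> real) \<Rightarrow>\<^sub>0 real\<close> with \<open>Poly_Mapping.keys \<nu> \<subseteq> A\<close>. These form a finite-dimensional
  subspace of a real normed vector space (with the l1 norm), so linear maps, dimension, convex
  cones and relative interiors are those of the library.
\<close>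

definition real_space :: "'i set \<Rightarrow> ('i \<Rightarrow> real) set" where
  "real_space I = I \<rightarrow>\<^sub>E UNIV"

definition nonneg_orthant :: "'i set \<Rightarrow> ('i \<Rightarrow> real) set" where
  "nonneg_orthant I = I \<rightarrow>\<^sub>E {0..}"

definition support_function :: "'i set \<Rightarrow> ('i \<Rightarrow> real) set \<Rightarrow> ('i \<Rightarrow> real) \<Rightarrow> ereal" where
  "support_function I X y = (SUP x\<in>X. ereal (\<Sum>i\<in>I. y i * x i))"

text \<open>The vector \<open>A\<nu> = \<Sum>\<^bsub>\<alpha>\<in>A\<^esub> \<alpha> \<nu>\<^sub>\<alpha>\<close> in \<open>\<real>\<^sup>I\<close>.\<close>

definition support_comb ::
    "'i set \<Rightarrow> ('i \<Rightarrow> real) set \<Rightarrow> (('i \<Rightarrow> real) \<Rightarrow>\<^sub>0 real) \<Rightarrow> 'i \<Rightarrow> real" where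
  "support_comb I A \<nu> = (\<lambda>i\<in>I. \<Sum>\<alpha>\<in>A. \<alpha> i * Poly_Mapping.lookup \<nu> \<alpha>)"

definition N_cone :: "('i \<Rightarrow> real) set \<Rightarrow> ('i \<Rightarrow> real) \<Rightarrow> (('i \<Rightarrow> real) \<Rightarrow>\<^sub>0 real) set" where
  "N_cone A \<beta> = {\<nu>. Poly_Mapping.keys \<nu> \<subseteq> A
      \<and> (\<forall>\<alpha>\<in>A - {\<beta>}. 0 \<le> Poly_Mapping.lookup \<nu> \<alpha>)
      \<and> (\<Sum>\<alpha>\<in>A. Poly_Mapping.lookup \<nu> \<alpha>) = 0}"

text \<open>The function \<open>\<nu> \<mapsto> \<sigma>\<^sub>X(-A\<nu>)\<close>.\<close>

definition sigma_neg ::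
    "'i set \<Rightarrow> ('i \<Rightarrow> real) set \<Rightarrow> ('i \<Rightarrow> real) set \<Rightarrow> (('i \<Rightarrow> real) \<Rightarrow>\<^sub>0 real) \<Rightarrow> ereal" where
  "sigma_neg I X A \<nu> = support_function I X (\<lambda>i\<in>I. - support_comb I A \<nu> i)"

text \<open>
  \<open>is_circuit I X A \<beta> \<nu>\<close>: \<open>\<nu> \<in> N\<^sub>\<beta>\<close> is an \<open>X\<close>-circuit for the support set \<open>A\<close>, where \<open>X\<close> is a
  non-empty convex subset of \<open>\<real>\<^sup>I\<close> and \<open>A\<close> is a finite subset of \<open>\<real>\<^sup>I\<close>. Every linear functional
  on \<open>\<real>\<^sup>A\<close> is the restriction of a linear functional \<open>L\<close> on the whole type.
\<close>

definition is_circuit ::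
    "'i set \<Rightarrow> ('i \<Rightarrow> real) set \<Rightarrow> ('i \<Rightarrow> real) set \<Rightarrow> ('i \<Rightarrow> real) \<Rightarrow> (('i \<Rightarrow> real) \<Rightarrow>\<^sub>0 real) \<Rightarrow> bool"
  where
  "is_circuit I X A \<beta> \<nu> \<longleftrightarrow>
      \<nu> \<in> N_cone A \<beta> \<and> \<nu> \<noteq> 0 \<and> sigma_neg I X A \<nu> < \<infinity> \<and>
      (\<forall>C. convex_cone C \<and> dim C = 2 \<and> C \<subseteq> N_cone A \<beta> \<and>
           (\<exists>L :: (('i \<Rightarrow> real) \<Rightarrow>\<^sub>0 real) \<Rightarrow> real. linear L \<and> (\<forall>\<mu>\<in>C. sigma_neg I X A \<mu> = ereal (L \<mu>)))
           \<longrightarrow> \<nu> \<notin> rel_interior C)"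

definition Lambda ::
    "'i set \<Rightarrow> ('i \<Rightarrow> real) set \<Rightarrow> ('i \<Rightarrow> real) set \<Rightarrow> ('i \<Rightarrow> real) \<Rightarrow> (('i \<Rightarrow> real) \<Rightarrow>\<^sub>0 real) set" where
  "Lambda I X A \<beta> = {\<nu>. is_circuit I X A \<beta> \<nu> \<and> Poly_Mapping.lookup \<nu> \<beta> = -1}"

definition restrict_support :: "'i set \<Rightarrow> ('i \<Rightarrow> real) set \<Rightarrow> ('i \<Rightarrow> real) set" where
  "restrict_support S A = (\<lambda>\<alpha>. restrict \<alpha> S) ` A"

text \<open>
  The vector \<open>l\<close> regarded as indexed by \<open>A\<^sub>S\<close>: if \<open>\<alpha> \<mapsto> \<alpha>\<^sub>S\<close> is injective on the support of \<open>l\<close>,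
  its entry at \<open>\<alpha>\<^sub>S\<close> is \<open>l\<^sub>\<alpha>\<close> for \<open>\<alpha>\<close> in the support, and all other entries are 0. (Without injectivity the
  entries over the same point would be added; the theorem uses only the injective case.)
\<close>

definition transport ::
    "'i set \<Rightarrow> (('i \<Rightarrow> real) \<Rightarrow>\<^sub>0 real) \<Rightarrow> (('i \<Rightarrow> real) \<Rightarrow>\<^sub>0 real)" where
  "transport S l = (\<Sum>\<alpha>\<in>Poly_Mapping.keys l.
      Poly_Mapping.single (restrict \<alpha> S) (Poly_Mapping.lookup l \<alpha>))"

lemma lookup_transport:
  assumes "inj_on (\<lambda>\<alpha>. restrict \<alpha> S) (Poly_Mapping.keys l)" and "\<alpha> \<in> Poly_Mapping.keys l"
  shows "Poly_Mapping.lookup (transport S l) (restrict \<alpha> S) = Poly_Mapping.lookup l \<alpha>"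
proof -
  have "Poly_Mapping.lookup (transport S l) (restrict \<alpha> S)
      = (\<Sum>\<gamma>\<in>Poly_Mapping.keys l. if \<gamma> = \<alpha> then Poly_Mapping.lookup l \<gamma> else 0)"
    unfolding transport_def lookup_sum lookup_single
    using assms by (intro sum.cong) (auto simp: when_def inj_on_def)
  then show ?thesis
    using assms(2) by (simp add: sum.delta)
qed

lemma lookup_transport_other:
  assumes "\<gamma> \<notin> (\<lambda>\<alpha>. restrict \<alpha> S) ` Poly_Mapping.keys l"
  shows "Poly_Mapping.lookup (transport S l) \<gamma> = 0"
  unfolding transport_def lookup_sum lookup_single
  using assms by (intro sum.neutral) (auto simp: when_def)

end

theory Submission
  imports Defs
begin

text \<open>
  For the orthant and for the whole space the function \<open>\<nu> \<mapsto> \<sigma>\<^sub>X(-A\<nu>)\<close> takes only the values \<open>0\<close> and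
  \<open>\<infinity>\<close>, so the circuits are exactly the generators of the extreme rays of the polyhedral cone
  \<open>K\<close> on which it vanishes: \<open>A\<nu> \<ge> 0\<close> for the orthant, \<open>A\<nu> = 0\<close> for the whole space. Whether \<open>\<lambda>\<close>
  spans an extreme ray is tested by perturbations \<open>\<lambda> \<plusminus> u \<in> K\<close>. Such a \<open>u\<close> is supported on the
  support of \<open>\<lambda>\<close> and satisfies \<open>(Au)\<^sub>i = 0\<close> wherever \<open>(A\<lambda>)\<^sub>i = 0\<close>; conversely small multiples of
  every such \<open>u\<close> with zero sum are admissible. With \<open>S\<close> the set of coordinates where \<open>A\<lambda>\<close> vanishes,
  this is the same test as for \<open>A\<^sub>S\<close> and the whole space. If \<open>S\<close> were empty or two support
  points had the same projection, the difference of two unit vectors would be an admissible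
  direction not proportional to \<open>\<lambda>\<close>; this is where \<open>\<bar>\<lambda>\<^sup>+\<bar> \<ge> 2\<close> enters.
\<close>

section \<open>Extreme rays and two-dimensional cones\<close>

text \<open>For a convex cone \<open>K\<close> this is the symmetric form of extremality: the
  smallest face containing \<open>v\<close> spans only the line of \<open>v\<close>. It can be
  tested one direction at a time, without naming faces.\<close>

definition extreme_ray :: "'a::real_vector set \<Rightarrow> 'a \<Rightarrow> bool" where
  "extreme_ray K v \<longleftrightarrow> v \<in> K \<and> v \<noteq> 0 \<and> (\<forall>u. v + u \<in> K \<longrightarrow> v - u \<in> K \<longrightarrow> u \<in> span {v})"

text \<open>The norm of the combination attains its minimum on the compact unit circle of
  coefficients. Independence makes this minimum positive, and homogeneity extends the bound to all
  coefficients. It is used to control the coefficients of points of the plane that are close to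
  \<open>v\<close>.\<close>

lemma norm_comb_lower_bound:
  fixes v u :: "'a::real_normed_vector"
  assumes "v \<noteq> 0" "u \<notin> span {v}"
  shows "\<exists>m>0. \<forall>a b. m * norm (a, b) \<le> norm (a *\<^sub>R v + b *\<^sub>R u)"
proof -
  let ?g = "\<lambda>p::real \<times> real. norm (fst p *\<^sub>R v + snd p *\<^sub>R u)"
  have cont: "continuous_on (sphere 0 1) ?g"
    by (intro continuous_intros)
  have "(1, 0) \<in> sphere (0::real \<times> real) 1"
    by (simp add: norm_Pair)
  then obtain p where p: "p \<in> sphere 0 1" "\<And>q. q \<in> sphere 0 1 \<Longrightarrow> ?g p \<le> ?g q"
    using continuous_attains_inf[OF compact_sphere _ cont] by blast
  have pos: "?g p > 0"
  proof (rule ccontr)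
    assume "\<not> ?g p > 0"
    then have eq: "fst p *\<^sub>R v + snd p *\<^sub>R u = 0" by simp
    have "snd p = 0"
    proof (rule ccontr)
      assume nz: "snd p \<noteq> 0"
      have "snd p *\<^sub>R u = - fst p *\<^sub>R v"
        using eq by (simp add: eq_neg_iff_add_eq_0 add.commute)
      then have "(1 / snd p) *\<^sub>R (snd p *\<^sub>R u) = (1 / snd p) *\<^sub>R (- fst p *\<^sub>R v)" by simp
      then have "u = (- fst p / snd p) *\<^sub>R v" using nz by simp
      then show False
        using assms(2) by (metis span_base span_scale insertI1)
    qed
    with eq assms(1) have "p = 0" by (simp add: prod_eq_iff)
    with p(1) show False by simp
  qed
  have "?g p * norm (a, b) \<le> norm (a *\<^sub>R v + b *\<^sub>R u)" for a b
  proof (cases "(a, b) = 0")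
    case False
    define r where "r = norm (a, b)"
    have r: "r > 0" using False r_def by simp
    have "(1 / r) *\<^sub>R (a, b) \<in> sphere 0 1" using r r_def by (simp del: scaleR_Pair)
    then have "?g p \<le> ?g ((1 / r) *\<^sub>R (a, b))" by (rule p(2))
    also have "\<dots> = norm ((1 / r) *\<^sub>R (a *\<^sub>R v + b *\<^sub>R u))" by (simp add: scaleR_add_right)
    also have "\<dots> = norm (a *\<^sub>R v + b *\<^sub>R u) / r" using r by simp
    finally show ?thesis using r by (simp add: field_simps r_def)
  qed simp
  with pos show ?thesis by blast
qed

text \<open>From a relative interior point one can move a little both ways along a second direction
  of \<open>C\<close> without leaving \<open>C\<close>. Extremality forbids exactly such a
  move.\<close>

lemma extreme_ray_imp_not_rel_interior:
  fixes K :: "'a::real_normed_vector set"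
  assumes ext: "extreme_ray K v" and C: "convex_cone C" "dim C = 2" "C \<subseteq> K"
  shows "v \<notin> rel_interior C"
proof
  assume "v \<in> rel_interior C"
  then obtain e where e: "v \<in> C" "e > 0" "ball v e \<inter> affine hull C \<subseteq> C"
    by (auto simp: mem_rel_interior_ball)
  \<comment> \<open>A set inside the line of \<open>v\<close> has dimension at most 1.\<close>
  have "\<not> C \<subseteq> span {v}"
    using dim_le_card[of C "{v}"] C(2) by auto
  then obtain w where w: "w \<in> C" "w \<notin> span {v}" by blast
  then have "w \<noteq> 0" using span_0 by metis
  \<comment> \<open>With this length \<open>t *\<^sub>R w\<close> has norm \<open>e / 2\<close>, so
    both moves stay in the ball around \<open>v\<close>.\<close>
  define t where "t = e / (2 * norm w)"
  have t: "t > 0" "\<bar>t\<bar> * norm w < e"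
    using e(2) \<open>w \<noteq> 0\<close> by (simp_all add: t_def)
  have vw: "v + w \<in> C" using C(1) e(1) w(1) by (simp add: convex_cone_add)
  \<comment> \<open>The whole line through \<open>v\<close> and \<open>v + w\<close> lies in the
    affine hull, which also covers negative \<open>s\<close>.\<close>
  have aff: "v + s *\<^sub>R w \<in> affine hull C" for s
    using mem_affine[OF affine_affine_hull hull_inc[OF e(1)] hull_inc[OF vw],
        where u = "1 - s" and v = s]
    by (simp add: algebra_simps)
  have "v + t *\<^sub>R w \<in> C" "v + (- t) *\<^sub>R w \<in> C"
    using aff[of t] aff[of "- t"] t(2) by (auto simp: dist_norm intro!: subsetD[OF e(3)])
  then have "t *\<^sub>R w \<in> span {v}"
    using ext C(3) by (auto simp: extreme_ray_def)
  then have "(1 / t) *\<^sub>R (t *\<^sub>R w) \<in> span {v}" by (rule span_scale)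
  with w(2) t(1) show False by simp
qed

text \<open>Converse of the preceding lemma: a perturbation that violates extremality produces a
  forbidden cone, namely the one generated by \<open>v + u\<close> and \<open>v - u\<close>.\<close>

lemma two_dim_cone_around:
  fixes K :: "'a::real_normed_vector set"
  assumes K: "convex_cone K" and uK: "v + u \<in> K" "v - u \<in> K"
    and v: "v \<noteq> 0" and u: "u \<notin> span {v}"
  shows "\<exists>C. convex_cone C \<and> dim C = 2 \<and> C \<subseteq> K \<and> v \<in> rel_interior C"
proof -
  \<comment> \<open>The cone generated by \<open>v + u\<close> and \<open>v - u\<close>, written in
    the coordinates of \<open>v\<close> and \<open>u\<close>. There \<open>v\<close> is the point
    (1, 0), well inside the region \<open>\<bar>b\<bar> \<le> a\<close>.\<close>
  define C where "C = {a *\<^sub>R v + b *\<^sub>R u | a b. \<bar>b\<bar> \<le> a}"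
  have CI: "a *\<^sub>R v + b *\<^sub>R u \<in> C" if "\<bar>b\<bar> \<le> a" for a b
    using that C_def by blast
  have "convex_cone C"
    unfolding convex_cone_iff
  proof (intro conjI ballI allI impI)
    show "0 \<in> C" using CI[of 0 0] by simp
  next
    fix x y assume "x \<in> C" "y \<in> C"
    then obtain a b a' b' where "x = a *\<^sub>R v + b *\<^sub>R u" "y = a' *\<^sub>R v + b' *\<^sub>R u"
      and "\<bar>b\<bar> \<le> a" "\<bar>b'\<bar> \<le> a'" unfolding C_def by blast
    then show "x + y \<in> C" using CI[of "b + b'" "a + a'"] by (simp add: algebra_simps)
  next
    fix x and c :: real assume "x \<in> C" "0 \<le> c"
    then obtain a b where "x = a *\<^sub>R v + b *\<^sub>R u" "\<bar>b\<bar> \<le> a" unfolding C_def by blast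
    then show "c *\<^sub>R x \<in> C"
      using CI[of "c * b" "c * a"] \<open>0 \<le> c\<close> by (simp add: scaleR_add_right abs_mult mult_left_mono)
  qed
  moreover have "C \<subseteq> K"
  proof
    fix x assume "x \<in> C"
    then obtain a b where ab: "x = a *\<^sub>R v + b *\<^sub>R u" "\<bar>b\<bar> \<le> a" unfolding C_def by blast
    \<comment> \<open>The coefficients with respect to the two generators are non-negative exactly
      when \<open>\<bar>b\<bar> \<le> a\<close>.\<close>
    have "((a + b) / 2) *\<^sub>R (v + u) + ((a - b) / 2) *\<^sub>R (v - u)
        = ((a + b) / 2 + (a - b) / 2) *\<^sub>R v + ((a + b) / 2 - (a - b) / 2) *\<^sub>R u"
      by (simp only: scaleR_add_left scaleR_diff_left scaleR_add_right scaleR_diff_right) simp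
    also have "\<dots> = x" unfolding ab by (simp flip: add_divide_distrib diff_divide_distrib)
    finally have "x = ((a + b) / 2) *\<^sub>R (v + u) + ((a - b) / 2) *\<^sub>R (v - u)" ..
    moreover have "\<dots> \<in> K"
      using ab(2) by (intro convex_cone_add[OF K] convex_cone_scaleR[OF K] uK) auto
    ultimately show "x \<in> K" by simp
  qed
  moreover have Cspan: "C \<subseteq> span {v, u}"
    unfolding C_def by (clarify, intro span_add span_scale span_base) auto
  moreover have "dim C = 2"
  proof -
    have vC: "v \<in> C" using CI[of 0 1] by simp
    have "v + u \<in> C" using CI[of 1 1] by simp
    then have "(v + u) - v \<in> span C" using vC by (intro span_diff span_base)
    then have "{v, u} \<subseteq> span C" using vC by (auto intro: span_base)
    then have "span {v, u} = span C"
      using Cspan by (metis span_mono span_span subset_antisym)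
    moreover have "independent {u, v}"
      using u v by (intro independent_insertI) (auto simp: independent_empty)
    moreover have "u \<noteq> v" using u span_base[of v "{v}"] by auto
    ultimately show ?thesis using dim_eq_card[of "{v, u}" C] by (simp add: insert_commute)
  qed
  moreover have "v \<in> rel_interior C"
  proof -
    obtain m where m: "m > 0" "\<And>a b. m * norm (a, b) \<le> norm (a *\<^sub>R v + b *\<^sub>R u)"
      using norm_comb_lower_bound[OF v u] by blast
    have "ball v (m / 2) \<inter> affine hull C \<subseteq> C"
    proof
      fix x assume x: "x \<in> ball v (m / 2) \<inter> affine hull C"
      then have "x \<in> span {v, u}"
        using affine_hull_subset_span Cspan by (metis IntD2 span_mono span_span subsetD)
      then obtain a b where ab: "x = a *\<^sub>R v + b *\<^sub>R u"
        by (auto simp: span_insert span_singleton algebra_simps)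
      have "m * norm (a - 1, b) \<le> norm ((a - 1) *\<^sub>R v + b *\<^sub>R u)" by (rule m(2))
      also have "\<dots> = dist v x" unfolding ab dist_norm
        by (subst norm_minus_commute) (simp add: algebra_simps)
      also have "\<dots> < m / 2" using x by simp
      finally have n: "norm (a - 1, b) < 1 / 2" using m(1) by simp
      \<comment> \<open>Both coordinates differ from those of \<open>v\<close> by less than 1/2, so
        \<open>a\<close> exceeds 1/2 while the modulus of \<open>b\<close> stays below it.\<close>
      have "\<bar>a - 1\<bar> \<le> norm (a - 1, b)" "\<bar>b\<bar> \<le> norm (a - 1, b)"
        using norm_fst_le[of "a - 1" b] norm_snd_le[of b "a - 1"] by auto
      with n have "\<bar>b\<bar> \<le> a" by linarith
      then show "x \<in> C" using CI ab by simp
    qed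
    moreover have "v \<in> C" using CI[of 0 1] by simp
    ultimately show ?thesis unfolding mem_rel_interior_ball using m(1)
      by (metis half_gt_zero)
  qed
  ultimately show ?thesis by blast
qed

section \<open>Circuits as extreme rays\<close>

lemma lookup_scaleR [simp]:
  "Poly_Mapping.lookup (c *\<^sub>R x) k = c *\<^sub>R Poly_Mapping.lookup x k"
proof -
  have "finite {i. c *\<^sub>R Poly_Mapping.lookup x i \<noteq> 0}"
    by (rule finite_subset[OF _ finite_keys[of x]]) (auto simp: in_keys_iff)
  then show ?thesis unfolding scaleR_poly_mapping_def by simp
qed

lemma keys_scaleR: "Poly_Mapping.keys (c *\<^sub>R x) \<subseteq> Poly_Mapping.keys x"
  by (auto simp: in_keys_iff)

lemma support_comb_linear:
  assumes "i \<in> I"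
  shows "support_comb I A (x + y) i = support_comb I A x i + support_comb I A y i"
    and "support_comb I A (x - y) i = support_comb I A x i - support_comb I A y i"
    and "support_comb I A (c *\<^sub>R x) i = c * support_comb I A x i"
    and "support_comb I A 0 i = 0"
  using assms
  by (simp_all add: support_comb_def lookup_add lookup_minus algebra_simps sum.distrib
      sum_subtractf sum_distrib_left)

lemma convex_cone_N_cone: "convex_cone (N_cone A \<beta>)"
  unfolding convex_cone_iff N_cone_def
proof (intro conjI ballI allI impI CollectI, goal_cases)
  case (4 x y)
  then show ?case using keys_add[of x y] by auto
next
  case (7 x c)
  then show ?case using keys_scaleR[of c x] by blast
qed (auto simp: lookup_add sum.distrib simp flip: sum_distrib_left)

section \<open>Zero sets of the support functions of the orthant and of the whole space\<close>

definition orthant_cone ::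
    "'i set \<Rightarrow> ('i \<Rightarrow> real) set \<Rightarrow> ('i \<Rightarrow> real) \<Rightarrow> (('i \<Rightarrow> real) \<Rightarrow>\<^sub>0 real) set" where
  "orthant_cone I A \<beta> = {\<nu> \<in> N_cone A \<beta>. \<forall>i\<in>I. support_comb I A \<nu> i \<ge> 0}"

definition kernel_cone ::
    "'i set \<Rightarrow> ('i \<Rightarrow> real) set \<Rightarrow> ('i \<Rightarrow> real) \<Rightarrow> (('i \<Rightarrow> real) \<Rightarrow>\<^sub>0 real) set" where
  "kernel_cone I A \<beta> = {\<nu> \<in> N_cone A \<beta>. \<forall>i\<in>I. support_comb I A \<nu> i = 0}"

lemma convex_cone_orthant_cone: "convex_cone (orthant_cone I A \<beta>)"
  using convex_cone_N_cone[of A \<beta>]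
  by (simp add: convex_cone_iff orthant_cone_def support_comb_linear)

lemma convex_cone_kernel_cone: "convex_cone (kernel_cone I A \<beta>)"
  using convex_cone_N_cone[of A \<beta>]
  by (simp add: convex_cone_iff kernel_cone_def support_comb_linear)

text \<open>The points of \<open>X\<close> supported on the single coordinate \<open>j\<close>
  already suffice: the one with entry \<open>t / y j\<close> has inner product exactly
  \<open>t\<close> with \<open>y\<close>.\<close>

lemma support_function_infinite:
  assumes "finite I" "j \<in> I" "y j \<noteq> 0"
    and "\<And>t. t \<ge> 0 \<Longrightarrow> (\<lambda>i\<in>I. if i = j then t / y j else 0) \<in> X"
  shows "support_function I X y = \<infinity>"
  unfolding support_function_def
proof (rule SUP_PInfty)
  fix m :: nat
  let ?x = "\<lambda>i\<in>I. if i = j then real m / y j else 0"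
  have "(\<Sum>i\<in>I. y i * ?x i) = (\<Sum>i\<in>I. if i = j then real m else 0)"
    using assms(3) by (intro sum.cong) auto
  also have "\<dots> = real m" using assms(1,2) by simp
  finally show "\<exists>x\<in>X. ereal (real m) \<le> ereal (\<Sum>i\<in>I. y i * x i)"
    using assms(4)[of "real m"] by (intro bexI[of _ ?x]) auto
qed

lemma support_function_zero:
  assumes "(\<lambda>i\<in>I. 0) \<in> X" "\<And>x. x \<in> X \<Longrightarrow> (\<Sum>i\<in>I. y i * x i) \<le> 0"
  shows "support_function I X y = 0"
  unfolding support_function_def
proof (rule antisym)
  show "(SUP x\<in>X. ereal (\<Sum>i\<in>I. y i * x i)) \<le> 0"
    using assms(2) by (intro SUP_least) simp
  have "(\<Sum>i\<in>I. y i * (\<lambda>i\<in>I. 0) i) = 0" by simp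
  then show "0 \<le> (SUP x\<in>X. ereal (\<Sum>i\<in>I. y i * x i))"
    by (intro SUP_upper2[OF assms(1)]) simp
qed

lemma sigma_neg_orthant:
  assumes "finite I"
  shows "sigma_neg I (nonneg_orthant I) A \<nu>
    = (if \<forall>i\<in>I. support_comb I A \<nu> i \<ge> 0 then 0 else \<infinity>)"
proof (cases "\<forall>i\<in>I. support_comb I A \<nu> i \<ge> 0")
  case True
  have "sigma_neg I (nonneg_orthant I) A \<nu> = 0"
    unfolding sigma_neg_def
    by (rule support_function_zero)
      (use True in \<open>auto simp: nonneg_orthant_def intro!: sum_nonpos mult_nonneg_nonneg\<close>)
  then show ?thesis using True by simp
next
  case False
  \<comment> \<open>At such a \<open>j\<close> the vector \<open>-A\<nu>\<close> has a positive
    entry, so the test points of \<open>support_function_infinite\<close> have non-negative entries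
    and lie in the orthant.\<close>
  then obtain j where j: "j \<in> I" "support_comb I A \<nu> j < 0" by (auto simp: not_le)
  have "sigma_neg I (nonneg_orthant I) A \<nu> = \<infinity>"
    unfolding sigma_neg_def
    by (rule support_function_infinite[OF assms j(1)])
      (use j in \<open>auto simp: nonneg_orthant_def intro!: divide_nonneg_neg divide_nonneg_pos\<close>)
  then show ?thesis using False by simp
qed

lemma sigma_neg_real_space:
  assumes "finite I"
  shows "sigma_neg I (real_space I) A \<nu>
    = (if \<forall>i\<in>I. support_comb I A \<nu> i = 0 then 0 else \<infinity>)"
proof (cases "\<forall>i\<in>I. support_comb I A \<nu> i = 0")
  case True
  have "sigma_neg I (real_space I) A \<nu> = 0"
    unfolding sigma_neg_def
    by (rule support_function_zero) (use True in \<open>auto simp: real_space_def\<close>)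
  then show ?thesis using True by simp
next
  case False
  then obtain j where j: "j \<in> I" "support_comb I A \<nu> j \<noteq> 0" by auto
  have "sigma_neg I (real_space I) A \<nu> = \<infinity>"
    unfolding sigma_neg_def
    by (rule support_function_infinite[OF assms j(1)]) (use j in \<open>auto simp: real_space_def\<close>)
  then show ?thesis using False by simp
qed

text \<open>As only the values 0 and infinity occur, agreeing with a linear functional on
  \<open>C\<close> means that \<open>C\<close> lies in the zero set, with the zero functional as
  witness. The circuit condition thus forbids two-dimensional cones in the zero set around the
  vector, which the two cone lemmas identify with extremality. The predicate \<open>P\<close> lets
  one proof serve both the orthant and the whole space.\<close>

lemma is_circuit_iff_extreme_ray:
  assumes sigma: "\<And>\<mu>. sigma_neg I X A \<mu> = (if P \<mu> then 0 else \<infinity>)"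
    and cone: "convex_cone {\<mu> \<in> N_cone A \<beta>. P \<mu>}"
  shows "is_circuit I X A \<beta> \<nu> \<longleftrightarrow> extreme_ray {\<mu> \<in> N_cone A \<beta>. P \<mu>} \<nu>"
proof -
  let ?K = "{\<mu> \<in> N_cone A \<beta>. P \<mu>}"
  have lin: "(C \<subseteq> N_cone A \<beta> \<and> (\<exists>L :: _ \<Rightarrow> real. linear L \<and> (\<forall>\<mu>\<in>C. sigma_neg I X A \<mu> = ereal (L \<mu>))))
      \<longleftrightarrow> C \<subseteq> ?K" for C
  proof
    assume "C \<subseteq> ?K"
    then show "C \<subseteq> N_cone A \<beta> \<and> (\<exists>L :: _ \<Rightarrow> real. linear L \<and> (\<forall>\<mu>\<in>C. sigma_neg I X A \<mu> = ereal (L \<mu>)))"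
      by (auto simp: sigma intro!: exI[of _ "\<lambda>_. 0"] linear_zero)
  next
    assume "C \<subseteq> N_cone A \<beta> \<and> (\<exists>L :: _ \<Rightarrow> real. linear L \<and> (\<forall>\<mu>\<in>C. sigma_neg I X A \<mu> = ereal (L \<mu>)))"
    then obtain L :: "_ \<Rightarrow> real"
      where "C \<subseteq> N_cone A \<beta>" "\<forall>\<mu>\<in>C. sigma_neg I X A \<mu> = ereal (L \<mu>)" by blast
    then show "C \<subseteq> ?K" by (auto simp: sigma split: if_splits)
  qed
  have "is_circuit I X A \<beta> \<nu> \<longleftrightarrow> \<nu> \<in> ?K \<and> \<nu> \<noteq> 0 \<and>
      (\<forall>C. convex_cone C \<and> dim C = 2 \<and> C \<subseteq> ?K \<longrightarrow> \<nu> \<notin> rel_interior C)"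
    unfolding is_circuit_def lin by (auto simp: sigma)
  also have "\<dots> \<longleftrightarrow> extreme_ray ?K \<nu>"
    using two_dim_cone_around[OF cone, of \<nu>] extreme_ray_imp_not_rel_interior[of ?K \<nu>]
    unfolding extreme_ray_def by meson
  finally show ?thesis .
qed

lemma is_circuit_orthant:
  assumes "finite I"
  shows "is_circuit I (nonneg_orthant I) A \<beta> \<nu> \<longleftrightarrow> extreme_ray (orthant_cone I A \<beta>) \<nu>"
  using is_circuit_iff_extreme_ray[OF sigma_neg_orthant[OF assms]]
    convex_cone_orthant_cone[of I A \<beta>] unfolding orthant_cone_def by blast

lemma is_circuit_real_space:
  assumes "finite I"
  shows "is_circuit I (real_space I) A \<beta> \<nu> \<longleftrightarrow> extreme_ray (kernel_cone I A \<beta>) \<nu>"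
  using is_circuit_iff_extreme_ray[OF sigma_neg_real_space[OF assms]]
    convex_cone_kernel_cone[of I A \<beta>] unfolding kernel_cone_def by blast

section \<open>Projection of vectors\<close>

text \<open>Points outside the support contribute zero terms, so several vectors can be projected by
  sums over one common index set.\<close>

lemma transport_eq_sum:
  assumes "finite B" "Poly_Mapping.keys \<nu> \<subseteq> B"
  shows "transport S \<nu> = (\<Sum>\<alpha>\<in>B. Poly_Mapping.single (restrict \<alpha> S) (Poly_Mapping.lookup \<nu> \<alpha>))"
  unfolding transport_def using assms
  by (intro sum.mono_neutral_left) (auto simp: in_keys_iff)

lemma lookup_transport_sum:
  assumes "finite B" "Poly_Mapping.keys \<nu> \<subseteq> B"
  shows "Poly_Mapping.lookup (transport S \<nu>) \<gamma>
    = (\<Sum>\<alpha>\<in>B. if restrict \<alpha> S = \<gamma> then Poly_Mapping.lookup \<nu> \<alpha> else 0)"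
  by (simp add: transport_eq_sum[OF assms] lookup_sum lookup_single when_def)

lemma transport_linear:
  shows "transport S (x + y) = transport S x + transport S y"
    and "transport S (x - y) = transport S x - transport S y"
    and "transport S (c *\<^sub>R x) = c *\<^sub>R transport S x"
proof -
  let ?B = "Poly_Mapping.keys x \<union> Poly_Mapping.keys y"
  have B: "Poly_Mapping.keys x \<subseteq> ?B" "Poly_Mapping.keys y \<subseteq> ?B" "finite ?B"
    "Poly_Mapping.keys (x + y) \<subseteq> ?B" "Poly_Mapping.keys (x - y) \<subseteq> ?B"
    "Poly_Mapping.keys (c *\<^sub>R x) \<subseteq> ?B"
    using keys_add[of x y] keys_diff[of x y] keys_scaleR[of c x] by auto
  note L = lookup_transport_sum[OF B(3)]
  show "transport S (x + y) = transport S x + transport S y"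
    by (rule poly_mapping_eqI)
      (auto simp: L B(1,2,4) lookup_add simp flip: sum.distrib intro!: sum.cong)
  show "transport S (x - y) = transport S x - transport S y"
    by (rule poly_mapping_eqI)
      (auto simp: L B(1,2,5) lookup_minus simp flip: sum_subtractf intro!: sum.cong)
  show "transport S (c *\<^sub>R x) = c *\<^sub>R transport S x"
    by (rule poly_mapping_eqI)
      (auto simp: L B(1,6) sum_distrib_left intro!: sum.cong)
qed

text \<open>Every \<alpha> contributes to exactly one point of the projection, so interchanging the
  two sums regroups the fibres. Taking \<open>f\<close> constant 1 transfers the zero-sum condition;
  taking a coordinate function transfers \<open>support_comb\<close>.\<close>

lemma sum_transport:
  assumes "finite A" "Poly_Mapping.keys \<nu> \<subseteq> A"
  shows "(\<Sum>\<gamma>\<in>restrict_support S A. f \<gamma> * Poly_Mapping.lookup (transport S \<nu>) \<gamma>)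
    = (\<Sum>\<alpha>\<in>A. f (restrict \<alpha> S) * Poly_Mapping.lookup \<nu> \<alpha>)"
proof -
  let ?R = "restrict_support S A"
  have "(\<Sum>\<gamma>\<in>?R. f \<gamma> * Poly_Mapping.lookup (transport S \<nu>) \<gamma>)
    = (\<Sum>\<gamma>\<in>?R. \<Sum>\<alpha>\<in>A. if restrict \<alpha> S = \<gamma> then f \<gamma> * Poly_Mapping.lookup \<nu> \<alpha> else 0)"
    by (auto simp: lookup_transport_sum[OF assms] sum_distrib_left intro!: sum.cong)
  also have "\<dots> = (\<Sum>\<alpha>\<in>A. \<Sum>\<gamma>\<in>?R. if restrict \<alpha> S = \<gamma> then f \<gamma> * Poly_Mapping.lookup \<nu> \<alpha> else 0)"
    by (rule sum.swap)
  also have "\<dots> = (\<Sum>\<alpha>\<in>A. f (restrict \<alpha> S) * Poly_Mapping.lookup \<nu> \<alpha>)"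
    using assms(1) by (intro sum.cong) (auto simp: restrict_support_def)
  finally show ?thesis .
qed

lemma support_comb_transport:
  assumes "finite A" "Poly_Mapping.keys \<nu> \<subseteq> A" "S \<subseteq> I" "i \<in> S"
  shows "support_comb S (restrict_support S A) (transport S \<nu>) i = support_comb I A \<nu> i"
  using sum_transport[OF assms(1,2), where f = "\<lambda>\<gamma>. \<gamma> i" and S = S] assms(3,4)
  by (auto simp: support_comb_def)

text \<open>Entries over one point add up. The fibre over a point other than
  \<open>restrict \<beta> S\<close> does not contain \<beta>, so its sum has only non-negative
  terms.\<close>

lemma transport_in_N_cone:
  assumes "finite A" "\<nu> \<in> N_cone A \<beta>"
  shows "transport S \<nu> \<in> N_cone (restrict_support S A) (restrict \<beta> S)"
proof -
  have k: "Poly_Mapping.keys \<nu> \<subseteq> A" using assms(2) by (simp add: N_cone_def)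
  have "Poly_Mapping.keys (transport S \<nu>) \<subseteq> (\<lambda>\<alpha>. restrict \<alpha> S) ` Poly_Mapping.keys \<nu>"
    using lookup_transport_other by (metis in_keys_iff subsetI)
  then have "Poly_Mapping.keys (transport S \<nu>) \<subseteq> restrict_support S A"
    using k unfolding restrict_support_def by blast
  moreover have "0 \<le> Poly_Mapping.lookup (transport S \<nu>) \<gamma>" if "\<gamma> \<noteq> restrict \<beta> S" for \<gamma>
    unfolding lookup_transport_sum[OF assms(1) k]
    using assms(2) that by (intro sum_nonneg) (auto simp: N_cone_def)
  moreover have "(\<Sum>\<gamma>\<in>restrict_support S A. Poly_Mapping.lookup (transport S \<nu>) \<gamma>) = 0"
    using sum_transport[OF assms(1) k, where f = "\<lambda>_. 1" and S = S] assms(2)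
    by (simp add: N_cone_def)
  ultimately show ?thesis by (auto simp: N_cone_def)
qed

text \<open>The preimage is \<open>w\<close> pulled back along the injective projection. This lifts
  perturbations of the projected vector to perturbations of the original one.\<close>

lemma transport_onto:
  assumes inj: "inj_on (\<lambda>\<alpha>. restrict \<alpha> S) B" and "finite B"
    and w: "Poly_Mapping.keys w \<subseteq> (\<lambda>\<alpha>. restrict \<alpha> S) ` B"
  shows "\<exists>u. Poly_Mapping.keys u \<subseteq> B \<and> transport S u = w"
proof -
  define u where "u = (\<Sum>\<alpha>\<in>B. Poly_Mapping.single \<alpha> (Poly_Mapping.lookup w (restrict \<alpha> S)))"
  have lu: "Poly_Mapping.lookup u \<alpha> = (if \<alpha> \<in> B then Poly_Mapping.lookup w (restrict \<alpha> S) else 0)" for \<alpha>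
    using \<open>finite B\<close> by (simp add: u_def lookup_sum lookup_single when_def)
  have ku: "Poly_Mapping.keys u \<subseteq> B" by (auto simp: in_keys_iff lu split: if_splits)
  have "transport S u = w"
  proof (rule poly_mapping_eqI)
    fix \<gamma>
    have "Poly_Mapping.lookup (transport S u) \<gamma>
        = (\<Sum>\<alpha>\<in>B. if restrict \<alpha> S = \<gamma> then Poly_Mapping.lookup w (restrict \<alpha> S) else 0)"
      by (auto simp: lookup_transport_sum[OF \<open>finite B\<close> ku] lu intro!: sum.cong)
    also have "\<dots> = (\<Sum>\<delta>\<in>(\<lambda>\<alpha>. restrict \<alpha> S) ` B. if \<delta> = \<gamma> then Poly_Mapping.lookup w \<delta> else 0)"
      by (simp add: sum.reindex[OF inj] o_def)
    also have "\<dots> = Poly_Mapping.lookup w \<gamma>"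
      using \<open>finite B\<close> w by (auto simp: in_keys_iff)
    finally show "Poly_Mapping.lookup (transport S u) \<gamma> = Poly_Mapping.lookup w \<gamma>" .
  qed
  with ku show ?thesis by blast
qed

lemma transport_eq_0_iff:
  assumes "inj_on (\<lambda>\<alpha>. restrict \<alpha> S) B" "Poly_Mapping.keys x \<subseteq> B"
  shows "transport S x = 0 \<longleftrightarrow> x = 0"
proof
  assume "transport S x = 0"
  then have "Poly_Mapping.lookup x \<alpha> = 0" if "\<alpha> \<in> Poly_Mapping.keys x" for \<alpha>
    using lookup_transport[OF inj_on_subset[OF assms] that] by simp
  then show "x = 0" by (metis in_keys_iff lookup_zero poly_mapping_eqI)
qed (simp add: transport_def)

text \<open>Projection is linear, and it is injective on vectors supported on the support of
  \<open>v\<close>. Applying this to \<open>u - c *\<^sub>R v\<close> carries the proportionality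
  test over in both directions.\<close>

lemma transport_in_span_iff:
  assumes inj: "inj_on (\<lambda>\<alpha>. restrict \<alpha> S) (Poly_Mapping.keys v)"
    and u: "Poly_Mapping.keys u \<subseteq> Poly_Mapping.keys v"
  shows "transport S u \<in> span {transport S v} \<longleftrightarrow> u \<in> span {v}"
proof -
  have "transport S u = c *\<^sub>R transport S v \<longleftrightarrow> u = c *\<^sub>R v" for c
  proof -
    have "transport S (u - c *\<^sub>R v) = 0 \<longleftrightarrow> u - c *\<^sub>R v = 0"
      using keys_diff[of u "c *\<^sub>R v"] keys_scaleR[of c v] u
      by (intro transport_eq_0_iff[OF inj]) blast
    then show ?thesis by (simp add: transport_linear)
  qed
  then show ?thesis by (auto simp: span_singleton)
qed

section \<open>Perturbations\<close>

text \<open>Provides a step length \<open>e\<close> for which \<open>a j + e * b j\<close> and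
  \<open>a j - e * b j\<close> stay non-negative for all \<open>j\<close>. Each positive
  \<open>a j\<close> admits some step, each zero \<open>a j\<close> any step, and finitely many
  steps have a positive minimum.\<close>

lemma exists_uniform_scale:
  fixes a b :: "'a \<Rightarrow> real"
  assumes "finite J" "\<And>j. j \<in> J \<Longrightarrow> a j \<ge> 0" "\<And>j. j \<in> J \<Longrightarrow> a j = 0 \<Longrightarrow> b j = 0"
  shows "\<exists>e>0. \<forall>j\<in>J. e * \<bar>b j\<bar> \<le> a j"
  using assms
proof (induction J rule: finite_induct)
  case empty
  then show ?case by (auto intro: exI[of _ 1])
next
  case (insert k J)
  then obtain e where e: "e > 0" "\<forall>j\<in>J. e * \<bar>b j\<bar> \<le> a j" by auto
  obtain d where d: "d > 0" "d * \<bar>b k\<bar> \<le> a k"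
  proof (cases "b k = 0")
    case True
    with insert.prems(1)[of k] show ?thesis by (intro that[of 1]) auto
  next
    case False
    with insert.prems(1,2)[of k] have "a k > 0" by force
    with False show ?thesis by (intro that[of "a k / \<bar>b k\<bar>"]) auto
  qed
  have "min e d * \<bar>b j\<bar> \<le> a j" if "j \<in> insert k J" for j
  proof -
    have "min e d * \<bar>b j\<bar> \<le> e * \<bar>b j\<bar>" "min e d * \<bar>b j\<bar> \<le> d * \<bar>b j\<bar>"
      by (intro mult_right_mono; simp)+
    with that e(2) d(2) show ?thesis by force
  qed
  with e(1) d(1) show ?case by (intro exI[of _ "min e d"]) auto
qed

text \<open>A small multiple of \<open>u\<close> can be added to and subtracted from
  \<open>l\<close> inside the cone: \<open>u\<close> vanishes wherever a constraint is tight, and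
  the other constraints leave room. The support of \<open>u\<close> may include \<beta> because the
  sign of that entry is free.\<close>

lemma extreme_ray_orthant_cone_perturb:
  assumes fin: "finite I" "finite A" and ext: "extreme_ray (orthant_cone I A \<beta>) l"
    and u: "Poly_Mapping.keys u \<subseteq> insert \<beta> (Poly_Mapping.keys l)" "\<beta> \<in> A"
    and sum0: "(\<Sum>\<alpha>\<in>A. Poly_Mapping.lookup u \<alpha>) = 0"
    and ker: "\<And>i. i \<in> I \<Longrightarrow> support_comb I A l i = 0 \<Longrightarrow> support_comb I A u i = 0"
  shows "u \<in> span {l}"
proof -
  have l: "l \<in> orthant_cone I A \<beta>" using ext by (simp add: extreme_ray_def)
  then have lN: "Poly_Mapping.keys l \<subseteq> A" "\<forall>\<alpha>\<in>A - {\<beta>}. 0 \<le> Poly_Mapping.lookup l \<alpha>"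
    "(\<Sum>\<alpha>\<in>A. Poly_Mapping.lookup l \<alpha>) = 0" "\<And>i. i \<in> I \<Longrightarrow> 0 \<le> support_comb I A l i"
    by (auto simp: orthant_cone_def N_cone_def)
  obtain d where d: "d > 0"
    "\<forall>\<alpha>\<in>A - {\<beta>}. d * \<bar>Poly_Mapping.lookup u \<alpha>\<bar> \<le> Poly_Mapping.lookup l \<alpha>"
    using exists_uniform_scale[of "A - {\<beta>}" "Poly_Mapping.lookup l" "Poly_Mapping.lookup u"]
      fin(2) lN(2) u(1) by (auto simp: in_keys_iff subset_iff)
  obtain d' where d': "d' > 0"
    "\<forall>i\<in>I. d' * \<bar>support_comb I A u i\<bar> \<le> support_comb I A l i"
    using exists_uniform_scale[of I "support_comb I A l" "support_comb I A u"]
      fin(1) lN(4) ker by auto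
  \<comment> \<open>One step length respects both the sign constraints on entries and the
    constraints on the coordinates of \<open>support_comb\<close>.\<close>
  define e where "e = min d d'"
  have e: "e > 0" using d d' e_def by simp
  have e1: "\<bar>e * Poly_Mapping.lookup u \<alpha>\<bar> \<le> Poly_Mapping.lookup l \<alpha>" if "\<alpha> \<in> A - {\<beta>}" for \<alpha>
    using d(2) that e mult_right_mono[of e d "\<bar>Poly_Mapping.lookup u \<alpha>\<bar>"]
    by (force simp: e_def abs_mult)
  have e2: "\<bar>e * support_comb I A u i\<bar> \<le> support_comb I A l i" if "i \<in> I" for i
    using d'(2) that e mult_right_mono[of e d' "\<bar>support_comb I A u i\<bar>"]
    by (force simp: e_def abs_mult)
  have mem: "l + c *\<^sub>R u \<in> orthant_cone I A \<beta>" if c: "\<bar>c\<bar> = e" for c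
  proof -
    have "Poly_Mapping.keys (l + c *\<^sub>R u) \<subseteq> A"
      using keys_add[of l "c *\<^sub>R u"] keys_scaleR[of c u] u lN(1) by blast
    moreover have "0 \<le> Poly_Mapping.lookup (l + c *\<^sub>R u) \<alpha>" if "\<alpha> \<in> A - {\<beta>}" for \<alpha>
      using e1[OF that] c e by (auto simp: lookup_add abs_mult abs_le_iff abs_if split: if_splits)
    moreover have "(\<Sum>\<alpha>\<in>A. Poly_Mapping.lookup (l + c *\<^sub>R u) \<alpha>) = 0"
      using lN(3) sum0 by (simp add: lookup_add sum.distrib flip: sum_distrib_left)
    moreover have "0 \<le> support_comb I A (l + c *\<^sub>R u) i" if "i \<in> I" for i
      using e2[OF that] c e that
      by (auto simp: support_comb_linear abs_mult abs_le_iff abs_if split: if_splits)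
    ultimately show ?thesis by (auto simp: orthant_cone_def N_cone_def)
  qed
  have "l + e *\<^sub>R u \<in> orthant_cone I A \<beta>" "l - e *\<^sub>R u \<in> orthant_cone I A \<beta>"
    using mem[of e] mem[of "- e"] e by auto
  then have "e *\<^sub>R u \<in> span {l}" using ext by (simp add: extreme_ray_def)
  then have "(1 / e) *\<^sub>R (e *\<^sub>R u) \<in> span {l}" by (rule span_scale)
  then show ?thesis using e by simp
qed

text \<open>Where \<open>v\<close> has a zero entry the index is not \<beta>, so both
  \<open>u\<close> and \<open>-u\<close> must be non-negative there.\<close>

lemma N_cone_perturb_keys:
  assumes "v + u \<in> N_cone A \<beta>" "v - u \<in> N_cone A \<beta>" "\<beta> \<in> Poly_Mapping.keys v"
  shows "Poly_Mapping.keys u \<subseteq> Poly_Mapping.keys v"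
proof
  fix \<alpha> assume a: "\<alpha> \<in> Poly_Mapping.keys u"
  show "\<alpha> \<in> Poly_Mapping.keys v"
  proof (rule ccontr)
    assume n: "\<alpha> \<notin> Poly_Mapping.keys v"
    then have v0: "Poly_Mapping.lookup v \<alpha> = 0" by (simp add: in_keys_iff)
    with a have "\<alpha> \<in> Poly_Mapping.keys (v + u)" by (simp add: in_keys_iff lookup_add)
    then have "\<alpha> \<in> A - {\<beta>}" using assms n by (auto simp: N_cone_def)
    then have "0 \<le> Poly_Mapping.lookup (v + u) \<alpha>" "0 \<le> Poly_Mapping.lookup (v - u) \<alpha>"
      using assms by (auto simp: N_cone_def)
    with v0 a show False by (simp add: lookup_add lookup_minus in_keys_iff)
  qed
qed

lemma sum_lookup_single_diff:
  assumes "finite A" "p \<in> A" "q \<in> A"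
  shows "(\<Sum>\<alpha>\<in>A. f \<alpha> * Poly_Mapping.lookup (Poly_Mapping.single p 1 - Poly_Mapping.single q 1) \<alpha>)
    = f p - (f q :: real)"
proof -
  have "(\<Sum>\<alpha>\<in>A. f \<alpha> * Poly_Mapping.lookup (Poly_Mapping.single p 1 - Poly_Mapping.single q 1) \<alpha>)
    = (\<Sum>\<alpha>\<in>A. (if \<alpha> = p then f p else 0) - (if \<alpha> = q then f q else 0))"
    by (intro sum.cong) (auto simp: lookup_minus lookup_single when_def)
  then show ?thesis using assms by (simp add: sum_subtractf)
qed

text \<open>If \<open>p\<close> and \<open>q\<close> agreed on every coordinate where
  \<open>A\<lambda>\<close> vanishes, the difference of their unit vectors would be an admissible
  perturbation. This single statement yields both the non-emptiness of \<open>S\<close> and the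
  injectivity of the projection.\<close>

lemma extreme_ray_imp_separated:
  assumes fin: "finite I" "finite A" and ext: "extreme_ray (orthant_cone I A \<beta>) l"
    and \<beta>: "\<beta> \<in> A" "Poly_Mapping.lookup l \<beta> = -1"
    and two: "card {\<alpha> \<in> A. Poly_Mapping.lookup l \<alpha> > 0} \<ge> 2"
    and pq: "p \<in> Poly_Mapping.keys l" "q \<in> Poly_Mapping.keys l" "p \<noteq> q"
  shows "\<exists>i\<in>I. support_comb I A l i = 0 \<and> p i \<noteq> q i"
proof (rule ccontr)
  assume "\<not> ?thesis"
  then have no: "\<And>i. i \<in> I \<Longrightarrow> support_comb I A l i = 0 \<Longrightarrow> p i = q i" by blast
  define u :: "('a \<Rightarrow> real) \<Rightarrow>\<^sub>0 real" where "u = Poly_Mapping.single p 1 - Poly_Mapping.single q 1"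
  have lA: "Poly_Mapping.keys l \<subseteq> A"
    using ext by (auto simp: extreme_ray_def orthant_cone_def N_cone_def)
  have pqA: "p \<in> A" "q \<in> A" using pq lA by auto
  have ku: "Poly_Mapping.keys u \<subseteq> {p, q}"
    using keys_diff[of "Poly_Mapping.single p (1::real)" "Poly_Mapping.single q 1"] by (auto simp: u_def)
  have "u \<in> span {l}"
  proof (rule extreme_ray_orthant_cone_perturb[OF fin ext _ \<beta>(1)])
    show "Poly_Mapping.keys u \<subseteq> insert \<beta> (Poly_Mapping.keys l)" using ku pq by blast
    show "(\<Sum>\<alpha>\<in>A. Poly_Mapping.lookup u \<alpha>) = 0"
      using sum_lookup_single_diff[OF fin(2) pqA, of "\<lambda>_. 1"] by (simp add: u_def)
    show "support_comb I A u i = 0" if "i \<in> I" "support_comb I A l i = 0" for i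
      using sum_lookup_single_diff[OF fin(2) pqA, of "\<lambda>\<alpha>. \<alpha> i"] no[OF that] that(1)
      by (simp add: u_def support_comb_def)
  qed
  then obtain c where c: "u = c *\<^sub>R l" by (auto simp: span_singleton)
  have up: "Poly_Mapping.lookup u p = 1"
    using pq(3) by (simp add: u_def lookup_minus lookup_single when_def)
  then have "c \<noteq> 0" using c by auto
  \<comment> \<open>Proportionality to \<open>u\<close> confines the support of \<open>l\<close> to
    two points. One of them is \<beta> with a negative entry, which leaves at most one positive
    entry.\<close>
  then have kl: "Poly_Mapping.keys l \<subseteq> {p, q}" using ku c by (auto simp: in_keys_iff)
  have "\<beta> \<in> Poly_Mapping.keys l" using \<beta>(2) by (simp add: in_keys_iff)
  then have "{\<alpha> \<in> A. Poly_Mapping.lookup l \<alpha> > 0} \<subseteq> {p, q} - {\<beta>}"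
    using kl \<beta>(2) by (auto simp: in_keys_iff subset_iff)
  then have "card {\<alpha> \<in> A. Poly_Mapping.lookup l \<alpha> > 0} \<le> card ({p, q} - {\<beta>})"
    by (intro card_mono) auto
  also have "\<dots> \<le> 1"
    using kl \<open>\<beta> \<in> Poly_Mapping.keys l\<close> pq(3) by (auto simp: card_Diff_singleton_if)
  finally show False using two by simp
qed

section \<open>Orthant circuits as circuits of a projected support set\<close>

theorem theorem4p5:
  fixes n :: nat
    and A :: "(nat \<Rightarrow> real) set"
    and \<beta> :: "nat \<Rightarrow> real"
    and l :: "(nat \<Rightarrow> real) \<Rightarrow>\<^sub>0 real"
  assumes "n \<ge> 2"
    and "finite A" and "A \<noteq> {}" and "A \<subseteq> real_space {1..n}"
    and "\<beta> \<in> A"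
    and "l \<in> N_cone A \<beta>"
    and "Poly_Mapping.lookup l \<beta> = -1"
    and "card {\<alpha> \<in> A. Poly_Mapping.lookup l \<alpha> > 0} \<ge> 2"
  shows "l \<in> Lambda {1..n} (nonneg_orthant {1..n}) A \<beta> \<longleftrightarrow>
    (\<exists>S. S \<noteq> {} \<and> S \<subseteq> {1..n}
       \<and> card (restrict_support S (Poly_Mapping.keys l)) = card (Poly_Mapping.keys l)
       \<and> is_circuit S (real_space S) (restrict_support S A) (restrict \<beta> S) (transport S l)
       \<and> (\<forall>i \<in> {1..n} - S. support_comb {1..n} A l i > 0))"
proof -
  let ?I = "{1..n}" and ?k = "Poly_Mapping.keys l"
  note fA = \<open>finite A\<close>
  have kA: "?k \<subseteq> A" using \<open>l \<in> N_cone A \<beta>\<close> by (simp add: N_cone_def)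
  have bk: "\<beta> \<in> ?k" using assms(7) by (simp add: in_keys_iff)
  have l0: "l \<noteq> 0" using assms(7) by auto
  have inj_iff: "card (restrict_support S ?k) = card ?k \<longleftrightarrow> inj_on (\<lambda>\<alpha>. restrict \<alpha> S) ?k" for S
    unfolding restrict_support_def using inj_on_iff_eq_card[OF finite_keys] by blast
  have circ: "is_circuit S (real_space S) (restrict_support S A) (restrict \<beta> S) (transport S l)
      \<longleftrightarrow> extreme_ray (kernel_cone S (restrict_support S A) (restrict \<beta> S)) (transport S l)"
    if "S \<subseteq> ?I" for S
    using that by (intro is_circuit_real_space) (rule finite_subset, auto)
  have Lam: "l \<in> Lambda ?I (nonneg_orthant ?I) A \<beta> \<longleftrightarrow> extreme_ray (orthant_cone ?I A \<beta>) l"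
    using assms(7) by (simp add: Lambda_def is_circuit_orthant)
  show ?thesis
    unfolding Lam
  proof
    assume ext: "extreme_ray (orthant_cone ?I A \<beta>) l"
    define S where "S = {i \<in> ?I. support_comb ?I A l i = 0}"
    have SI: "S \<subseteq> ?I" by (auto simp: S_def)
    note sep = extreme_ray_imp_separated[OF finite_atLeastAtMost fA ext assms(5,7,8)]
    have "{\<alpha> \<in> A. Poly_Mapping.lookup l \<alpha> > 0} \<noteq> {}"
      using assms(8) by force
    then obtain p where p: "p \<in> A" "Poly_Mapping.lookup l p > 0" by blast
    then have "p \<in> ?k" "p \<noteq> \<beta>" using assms(7) by (auto simp: in_keys_iff)
    \<comment> \<open>Separating the two distinct support points \<open>p\<close> and \<beta> needs
      a coordinate where \<open>A\<lambda>\<close> vanishes.\<close>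
    then have "S \<noteq> {}" using sep[OF \<open>p \<in> ?k\<close> bk] unfolding S_def by blast
    moreover have inj: "inj_on (\<lambda>\<alpha>. restrict \<alpha> S) ?k"
    proof (rule inj_onI, rule ccontr)
      fix p q assume pq: "p \<in> ?k" "q \<in> ?k" "restrict p S = restrict q S" "p \<noteq> q"
      then obtain i where "i \<in> S" "p i \<noteq> q i" using sep[OF pq(1,2,4)] by (auto simp: S_def)
      then show False using fun_cong[OF pq(3), of i] by simp
    qed
    moreover have "\<forall>i \<in> ?I - S. support_comb ?I A l i > 0"
      using ext by (force simp: S_def extreme_ray_def orthant_cone_def less_le)
    moreover have "extreme_ray (kernel_cone S (restrict_support S A) (restrict \<beta> S)) (transport S l)"
      (is "extreme_ray ?K ?l")
      unfolding extreme_ray_def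
    proof (intro conjI allI impI)
      show lK: "?l \<in> ?K"
        unfolding kernel_cone_def
        using transport_in_N_cone[OF fA assms(6)] support_comb_transport[OF fA kA SI]
        by (auto simp: S_def)
      show "?l \<noteq> 0" using transport_eq_0_iff[OF inj order_refl] l0 by simp
      fix w assume w: "?l + w \<in> ?K" "?l - w \<in> ?K"
      \<comment> \<open>With the distinguished entry non-zero, \<open>w\<close> is confined to the
        projected support and can be lifted to a vector \<open>u\<close> on the support of
        \<open>l\<close>.\<close>
      have "restrict \<beta> S \<in> Poly_Mapping.keys ?l"
        using lookup_transport[OF inj bk] bk by (simp add: in_keys_iff)
      then have "Poly_Mapping.keys w \<subseteq> Poly_Mapping.keys ?l"
        using w by (intro N_cone_perturb_keys) (auto simp: kernel_cone_def)
      moreover have "Poly_Mapping.keys ?l \<subseteq> (\<lambda>\<alpha>. restrict \<alpha> S) ` ?k"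
        using lookup_transport_other by (metis in_keys_iff subsetI)
      ultimately obtain u where u: "Poly_Mapping.keys u \<subseteq> ?k" "transport S u = w"
        using transport_onto[OF inj finite_keys] by blast
      have uA: "Poly_Mapping.keys u \<subseteq> A" using u(1) kA by blast
      have "u \<in> span {l}"
      proof (rule extreme_ray_orthant_cone_perturb[OF finite_atLeastAtMost fA ext _ assms(5)])
        show "Poly_Mapping.keys u \<subseteq> insert \<beta> ?k" using u(1) by blast
        \<comment> \<open>Both \<open>?l\<close> and \<open>?l + w\<close> have zero sum, hence so
          does \<open>w\<close>; the same subtraction gives the vanishing of its coordinates on
          \<open>S\<close> below.\<close>
        have "(\<Sum>\<gamma>\<in>restrict_support S A. Poly_Mapping.lookup w \<gamma>) = 0"
          using w(1) lK by (simp add: kernel_cone_def N_cone_def lookup_add sum.distrib)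
        then show "(\<Sum>\<alpha>\<in>A. Poly_Mapping.lookup u \<alpha>) = 0"
          using sum_transport[OF fA uA, where f = "\<lambda>_. 1" and S = S] u(2) by simp
        show "support_comb ?I A u i = 0" if "i \<in> ?I" "support_comb ?I A l i = 0" for i
        proof -
          have iS: "i \<in> S" using that by (simp add: S_def)
          have "support_comb S (restrict_support S A) w i = 0"
            using w(1) lK iS by (simp add: kernel_cone_def support_comb_linear)
          then show ?thesis using support_comb_transport[OF fA uA SI iS] u(2) by simp
        qed
      qed
      then show "w \<in> span {?l}" using transport_in_span_iff[OF inj u(1)] u(2) by simp
    qed
    ultimately show "\<exists>S. S \<noteq> {} \<and> S \<subseteq> ?I \<and> card (restrict_support S ?k) = card ?k
       \<and> is_circuit S (real_space S) (restrict_support S A) (restrict \<beta> S) (transport S l)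
       \<and> (\<forall>i \<in> ?I - S. support_comb ?I A l i > 0)"
      using SI circ[OF SI] inj_iff[of S] by blast
  next
    assume "\<exists>S. S \<noteq> {} \<and> S \<subseteq> ?I \<and> card (restrict_support S ?k) = card ?k
       \<and> is_circuit S (real_space S) (restrict_support S A) (restrict \<beta> S) (transport S l)
       \<and> (\<forall>i \<in> ?I - S. support_comb ?I A l i > 0)"
    then obtain S where SI: "S \<subseteq> ?I" and inj: "inj_on (\<lambda>\<alpha>. restrict \<alpha> S) ?k"
      and ext: "extreme_ray (kernel_cone S (restrict_support S A) (restrict \<beta> S)) (transport S l)"
      and pos: "\<forall>i \<in> ?I - S. support_comb ?I A l i > 0"
      using circ inj_iff by blast
    let ?K = "kernel_cone S (restrict_support S A) (restrict \<beta> S)"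
    \<comment> \<open>Together with \<open>pos\<close> this shows that a given \<open>S\<close> can
      only be the zero set of \<open>A\<lambda>\<close>.\<close>
    have zero: "support_comb ?I A l i = 0" if "i \<in> S" for i
      using ext support_comb_transport[OF fA kA SI that] that
      by (simp add: extreme_ray_def kernel_cone_def)
    show "extreme_ray (orthant_cone ?I A \<beta>) l"
      unfolding extreme_ray_def
    proof (intro conjI allI impI)
      show "l \<in> orthant_cone ?I A \<beta>"
        unfolding orthant_cone_def using assms(6) zero pos by (force simp: less_le)
      show "l \<noteq> 0" by (rule l0)
      fix u assume u: "l + u \<in> orthant_cone ?I A \<beta>" "l - u \<in> orthant_cone ?I A \<beta>"
      then have uN: "l + u \<in> N_cone A \<beta>" "l - u \<in> N_cone A \<beta>" by (auto simp: orthant_cone_def)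
      have ku: "Poly_Mapping.keys u \<subseteq> ?k" by (rule N_cone_perturb_keys[OF uN bk])
      have uz: "support_comb ?I A u i = 0" if "i \<in> S" for i
      proof -
        have iI: "i \<in> ?I" using that SI by blast
        \<comment> \<open>As \<open>A\<lambda>\<close> vanishes at \<open>i\<close>, the two
          inequalities bound the entry of \<open>Au\<close> by 0 from both sides.\<close>
        then have "0 \<le> support_comb ?I A (l + u) i" "0 \<le> support_comb ?I A (l - u) i"
          using u by (auto simp: orthant_cone_def)
        then show ?thesis
          unfolding support_comb_linear(1,2)[OF iI] using zero[OF that] by simp
      qed
      have mem: "transport S v \<in> ?K"
        if "v \<in> N_cone A \<beta>" "\<And>i. i \<in> S \<Longrightarrow> support_comb ?I A v i = 0" for v
      proof -
        have "Poly_Mapping.keys v \<subseteq> A" using that(1) by (simp add: N_cone_def)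
        then show ?thesis
          unfolding kernel_cone_def
          using transport_in_N_cone[OF fA that(1)] support_comb_transport[OF fA _ SI] that(2) by auto
      qed
      \<comment> \<open>The orthant perturbation projects to a two-sided perturbation in the kernel
        cone, where extremality of the projected vector applies.\<close>
      have "transport S (l + u) \<in> ?K" "transport S (l - u) \<in> ?K"
        using SI zero uz by (auto intro!: mem uN simp: support_comb_linear subset_iff)
      then have "transport S u \<in> span {transport S l}"
        using ext by (simp add: extreme_ray_def transport_linear)
      then show "u \<in> span {l}" using transport_in_span_iff[OF inj ku] by simp
    qed
  qed
qed

end
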